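(* Let $\epsilon\ge0$ and $\omega\in[-\tfrac12,\tfrac12]$, and consider on $[-1,1]$ the system $$s''=4s(\theta')^2+\epsilon\,s(s^2-1),\qquad s^2\theta'=B,$$ where $B$ is a real constant, subject to $s(-1)=s(1)=1$, $\theta(-1)=-\omega\pi$, $\theta(1)=\omega\pi$. For $B=\theta'(\pm1)\neq0$, the unique solution $(s,\theta)$ of this boundary value problem satisfies $$s(y)=s(-y),\qquad\theta(y)=-\theta(-y)\qquad\text{for all }y\in[-1,1],$$ and $s$ has a unique non-trivial minimum (i.e. with $s(0)>0$) at $y=0$.
   Context: Primes denote $d/dy$. The equation $s^2\theta'=B$ is the integrated form of $(s^2\theta')'=0$; since $s(\pm1)=1$, $B=\theta'(-1)=\theta'(1)$. Solutions are classical ($s$ at least $C^2$, $\theta$ at least $C^1$). "The unique solution" refers to the fact that, for fixed $\epsilon$ and $\omega$, this boundary value problem has at most one solution with $B\neq0$. *)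

theory Defs
  imports "HOL-Analysis.Analysis"
begin

text \<open>
  Classical solutions on the closed interval: \<open>s\<close> is \<open>C\<^sup>2\<close> and \<open>\<theta>\<close> is \<open>C\<^sup>1\<close> on \<open>[-1,1]\<close>, with
  one-sided derivatives at the endpoints.  The witnesses \<open>s1\<close>, \<open>s2\<close>, \<open>\<theta>1\<close> are \<open>s'\<close>, \<open>s''\<close>, \<open>\<theta>'\<close>;
  they are determined on \<open>[-1,1]\<close>.  The values of \<open>s\<close> and \<open>\<theta>\<close> outside \<open>[-1,1]\<close> are irrelevant.
\<close>

definition bvp_solution ::
  "real \<Rightarrow> real \<Rightarrow> real \<Rightarrow> (real \<Rightarrow> real) \<Rightarrow> (real \<Rightarrow> real) \<Rightarrow> bool" where
  "bvp_solution \<epsilon> \<omega> B s \<theta> \<longleftrightarrow>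
     (\<exists>s1 s2 \<theta>1.
        (\<forall>y\<in>{-1..1}. (s has_real_derivative s1 y) (at y within {-1..1})) \<and>
        (\<forall>y\<in>{-1..1}. (s1 has_real_derivative s2 y) (at y within {-1..1})) \<and>
        continuous_on {-1..1} s2 \<and>
        (\<forall>y\<in>{-1..1}. (\<theta> has_real_derivative \<theta>1 y) (at y within {-1..1})) \<and>
        continuous_on {-1..1} \<theta>1 \<and>
        (\<forall>y\<in>{-1..1}. s2 y = 4 * s y * (\<theta>1 y)\<^sup>2 + \<epsilon> * s y * ((s y)\<^sup>2 - 1)) \<and>
        (\<forall>y\<in>{-1..1}. (s y)\<^sup>2 * \<theta>1 y = B)) \<and>
     s (-1) = 1 \<and> s 1 = 1 \<and> \<theta> (-1) = - \<omega> * pi \<and> \<theta> 1 = \<omega> * pi"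

definition local_min_on :: "real set \<Rightarrow> (real \<Rightarrow> real) \<Rightarrow> real \<Rightarrow> bool" where
  "local_min_on S f y \<longleftrightarrow> y \<in> S \<and> (\<exists>d>0. \<forall>z\<in>S. \<bar>z - y\<bar> < d \<longrightarrow> f y \<le> f z)"

end

theory Submission
  imports Defs
begin

text \<open>
  Since \<open>s\<^sup>2 \<theta>' = B \<noteq> 0\<close>, the function \<open>s\<close> has no zero, so it is positive and solves the autonomous
  equation \<open>s'' = 4 B\<^sup>2 / s\<^sup>3 + \<epsilon> s (s\<^sup>2 - 1)\<close>, whose right-hand side is positive for \<open>s \<ge> 1\<close>.
  Hence \<open>s < 1\<close> in the interior.  By uniqueness for the initial value problem, \<open>s\<close> is symmetric about
  each of its critical points \<open>c\<close>; if \<open>c \<noteq> 0\<close> were interior, the reflection of the nearer endpoint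
  would be an interior point at which \<open>s = 1\<close>.  So \<open>0\<close> is the only interior critical point, and
  every claim follows.
\<close>

section \<open>Uniqueness for second-order initial value problems, and reflection\<close>

text \<open>Multiplying by the integrating factor \<open>exp (- K * t)\<close> turns the growth
  bound into a nonpositive derivative, so the product never rises above its initial value 0.\<close>

lemma gronwall_zero:
  fixes E E' :: "real \<Rightarrow> real"
  assumes deriv: "\<And>t. t \<in> {a..b} \<Longrightarrow> (E has_real_derivative E' t) (at t within {a..b})"
    and growth: "\<And>t. t \<in> {a..b} \<Longrightarrow> E' t \<le> K * E t"
    and nonneg: "\<And>t. t \<in> {a..b} \<Longrightarrow> 0 \<le> E t"
    and init: "E a = 0" and x: "x \<in> {a..b}"
  shows "E x = 0"
proof -
  let ?g = "\<lambda>t. E t * exp (- K * t)"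
  have g': "(?g has_real_derivative (E' t - K * E t) * exp (- K * t)) (at t within {a..b})"
    if "t \<in> {a..b}" for t
    using deriv[OF that] by (auto intro!: derivative_eq_intros simp: algebra_simps)
  have "?g x \<le> ?g a"
  proof (rule DERIV_nonpos_imp_decreasing_open[where f = ?g])
    show "a \<le> x" using x by simp
    show "continuous_on {a..x} ?g"
      using DERIV_continuous_on[OF g'] continuous_on_subset x by fastforce
    fix t assume t: "a < t" "t < x"
    then have "(?g has_real_derivative (E' t - K * E t) * exp (- K * t)) (at t)"
      using g'[of t] x at_within_Icc_at[of a t b] by simp
    moreover have "(E' t - K * E t) * exp (- K * t) \<le> 0"
      using growth[of t] t x by (simp add: mult_nonpos_nonneg)
    ultimately show "\<exists>y. (?g has_real_derivative y) (at t) \<and> y \<le> 0" by blast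
  qed
  then have "E x \<le> 0" using init by (simp add: mult_le_0_iff)
  then show ?thesis using nonneg[OF x] by simp
qed

text \<open>The squared phase-space distance of the two solutions vanishes at \<open>a\<close> and
  grows at most at rate \<open>1 + L\<close>, so Gronwall forces it to stay zero.\<close>

lemma second_order_ode_unique:
  fixes u u1 v v1 f :: "real \<Rightarrow> real"
  assumes lip: "L-lipschitz_on S f"
    and u: "\<And>t. t \<in> {a..b} \<Longrightarrow> (u has_real_derivative u1 t) (at t within {a..b})"
      "\<And>t. t \<in> {a..b} \<Longrightarrow> (u1 has_real_derivative f (u t)) (at t within {a..b})"
      "\<And>t. t \<in> {a..b} \<Longrightarrow> u t \<in> S"
    and v: "\<And>t. t \<in> {a..b} \<Longrightarrow> (v has_real_derivative v1 t) (at t within {a..b})"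
      "\<And>t. t \<in> {a..b} \<Longrightarrow> (v1 has_real_derivative f (v t)) (at t within {a..b})"
      "\<And>t. t \<in> {a..b} \<Longrightarrow> v t \<in> S"
    and init: "u a = v a" "u1 a = v1 a" and x: "x \<in> {a..b}"
  shows "u x = v x"
proof -
  let ?E = "\<lambda>t. (u t - v t)\<^sup>2 + (u1 t - v1 t)\<^sup>2"
  let ?E' = "\<lambda>t. 2 * (u t - v t) * (u1 t - v1 t) + 2 * (u1 t - v1 t) * (f (u t) - f (v t))"
  have "?E x = 0"
  proof (rule gronwall_zero[where E = ?E and E' = ?E' and K = "1 + L" and a = a and b = b])
    fix t assume t: "t \<in> {a..b}"
    show "(?E has_real_derivative ?E' t) (at t within {a..b})"
      using u(1,2)[OF t] v(1,2)[OF t] by (auto intro!: derivative_eq_intros simp: algebra_simps)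
    have L: "0 \<le> L" using lip by (rule lipschitz_on_nonneg)
    have amgm: "2 * (p * q) \<le> p\<^sup>2 + q\<^sup>2" for p q :: real
      using sum_squares_bound[of p q] by simp
    \<comment> \<open>With p = \<open>u t - v t\<close> and q = \<open>u1 t - v1 t\<close>, the
      first term 2pq of \<open>?E'\<close> is at most \<open>?E t\<close>. The Lipschitz bound
      reduces the second to 2L|p||q|, which is at most \<open>L * ?E t\<close>.\<close>
    have "\<bar>f (u t) - f (v t)\<bar> \<le> L * \<bar>u t - v t\<bar>"
      using lipschitz_onD[OF lip u(3)[OF t] v(3)[OF t]] by (simp add: dist_real_def)
    then have "\<bar>u1 t - v1 t\<bar> * \<bar>f (u t) - f (v t)\<bar> \<le> \<bar>u1 t - v1 t\<bar> * (L * \<bar>u t - v t\<bar>)"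
      by (rule mult_left_mono) simp
    then have "(u1 t - v1 t) * (f (u t) - f (v t)) \<le> L * (\<bar>u1 t - v1 t\<bar> * \<bar>u t - v t\<bar>)"
      using abs_ge_self[of "(u1 t - v1 t) * (f (u t) - f (v t))"]
      unfolding abs_mult mult.left_commute[of L] by linarith
    moreover have "L * (2 * (\<bar>u1 t - v1 t\<bar> * \<bar>u t - v t\<bar>)) \<le> L * ?E t"
      using mult_left_mono[OF amgm[of "\<bar>u1 t - v1 t\<bar>" "\<bar>u t - v t\<bar>"] L] by (simp add: add.commute)
    moreover have "2 * ((u t - v t) * (u1 t - v1 t)) \<le> ?E t" by (rule amgm)
    ultimately show "?E' t \<le> (1 + L) * ?E t" by (simp add: algebra_simps)
  qed (use init x in auto)
  then show ?thesis by (simp add: sum_power2_eq_zero_iff)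
qed

text \<open>An autonomous equation without first-order term is invariant under time reversal. Both
  branches leaving \<open>c\<close> therefore solve it, and they start with equal slopes since
  \<open>s1 c\<close> and \<open>- s1 c\<close> are both 0.\<close>

lemma autonomous_ode_reflection:
  fixes s s1 f :: "real \<Rightarrow> real"
  assumes lip: "L-lipschitz_on S f"
    and s: "\<And>y. y \<in> {a..b} \<Longrightarrow> (s has_real_derivative s1 y) (at y within {a..b})"
      "\<And>y. y \<in> {a..b} \<Longrightarrow> (s1 has_real_derivative f (s y)) (at y within {a..b})"
      "\<And>y. y \<in> {a..b} \<Longrightarrow> s y \<in> S"
    and crit: "s1 c = 0"
    and T: "0 \<le> T" "a \<le> c - T" "c + T \<le> b"
  shows "s (c + T) = s (c - T)"
proof -
  have img: "(\<lambda>t. c + t) ` {0..T} \<subseteq> {a..b}" "(\<lambda>t. c - t) ` {0..T} \<subseteq> {a..b}"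
    using T by auto
  have plus: "((\<lambda>t. g (c + t)) has_real_derivative D) (at t within {0..T})"
    if "(g has_real_derivative D) (at (c + t) within {a..b})" for g :: "real \<Rightarrow> real" and D t
  proof -
    have "((\<lambda>t. c + t) has_real_derivative 1) (at t within {0..T})"
      by (auto intro!: derivative_eq_intros)
    from DERIV_image_chain[OF has_field_derivative_subset[OF that img(1)] this]
    show ?thesis by (simp add: o_def)
  qed
  have minus: "((\<lambda>t. g (c - t)) has_real_derivative - D) (at t within {0..T})"
    if "(g has_real_derivative D) (at (c - t) within {a..b})" for g :: "real \<Rightarrow> real" and D t
  proof -
    have "((\<lambda>t. c - t) has_real_derivative -1) (at t within {0..T})"
      by (auto intro!: derivative_eq_intros)
    from DERIV_image_chain[OF has_field_derivative_subset[OF that img(2)] this]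
    show ?thesis by (simp add: o_def)
  qed
  show ?thesis
  proof (rule second_order_ode_unique[OF lip, where a = 0 and b = T
        and u = "\<lambda>t. s (c + t)" and v = "\<lambda>t. s (c - t)"
        and ?u1.0 = "\<lambda>t. s1 (c + t)" and ?v1.0 = "\<lambda>t. - s1 (c - t)"])
    fix t assume "t \<in> {0..T}"
    then have t: "c + t \<in> {a..b}" "c - t \<in> {a..b}" using T by auto
    show "((\<lambda>t. s (c + t)) has_real_derivative s1 (c + t)) (at t within {0..T})"
      "((\<lambda>t. s1 (c + t)) has_real_derivative f (s (c + t))) (at t within {0..T})"
      "((\<lambda>t. s (c - t)) has_real_derivative - s1 (c - t)) (at t within {0..T})"
      using plus[OF s(1)[OF t(1)]] plus[OF s(2)[OF t(1)]] minus[OF s(1)[OF t(2)]] by simp_all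
    \<comment> \<open>The sign from reversing time appears twice and cancels, so the reflected
      branch satisfies the same equation.\<close>
    show "((\<lambda>t. - s1 (c - t)) has_real_derivative f (s (c - t))) (at t within {0..T})"
      using DERIV_minus[OF minus[OF s(2)[OF t(2)]]] by simp
    show "s (c + t) \<in> S" "s (c - t) \<in> S" using t s(3) by auto
  qed (use crit T in auto)
qed

section \<open>Auxiliary facts from calculus\<close>

lemma C1_imp_lipschitz_on_Icc:
  fixes f f' :: "real \<Rightarrow> real"
  assumes deriv: "\<And>x. x \<in> {a..b} \<Longrightarrow> (f has_real_derivative f' x) (at x within {a..b})"
    and cont: "continuous_on {a..b} f'"
  obtains L where "L-lipschitz_on {a..b} f"
proof -
  have "bounded (f' ` {a..b})"
    using compact_continuous_image[OF cont] by (simp add: compact_imp_bounded)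
  then obtain L where L: "0 < L" "\<And>x. x \<in> {a..b} \<Longrightarrow> \<bar>f' x\<bar> \<le> L"
    by (auto simp: bounded_pos)
  have "L-lipschitz_on {a..b} f"
  proof (rule bounded_derivative_imp_lipschitz)
    fix x assume x: "x \<in> {a..b}"
    show "(f has_derivative (*) (f' x)) (at x within {a..b})"
      using deriv[OF x] by (simp add: has_field_derivative_def)
    show "onorm ((*) (f' x)) \<le> L"
      by (rule onorm_bound) (use L x in \<open>auto simp: abs_mult intro!: mult_right_mono\<close>)
  qed (use L in auto)
  then show thesis by (rule that)
qed

text \<open>A positive derivative of \<open>s1\<close> at its zero \<open>z\<close> makes
  \<open>s1\<close> positive just to the right of \<open>z\<close>, so \<open>s\<close> climbs above
  \<open>s z\<close> there.\<close>

lemma not_local_max_if_second_deriv_pos: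
  fixes s s1 :: "real \<Rightarrow> real"
  assumes s1: "\<And>y. y \<in> {a<..<b} \<Longrightarrow> (s has_real_derivative s1 y) (at y)"
    and s2: "(s1 has_real_derivative D) (at z)" "D > 0"
    and z: "z \<in> {a<..<b}" and crit: "s1 z = 0"
  shows "\<exists>y\<in>{a<..<b}. s y > s z"
proof -
  obtain d where d: "d > 0" "\<And>h. 0 < h \<Longrightarrow> h < d \<Longrightarrow> s1 z < s1 (z + h)"
    using DERIV_pos_inc_right[OF s2] by blast
  define h where "h = min d (b - z) / 2"
  have h: "0 < h" "h < d" "z + h < b" using d z by (auto simp: h_def min_def field_simps)
  have "s z < s (z + h)"
  proof (rule DERIV_pos_imp_increasing_open[where f = s])
    show "z < z + h" using h by simp
    fix x assume x: "z < x" "x < z + h"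
    then show "\<exists>y. (s has_real_derivative y) (at x) \<and> y > 0"
      using s1[of x] d(2)[of "x - z"] h z crit by (intro exI[of _ "s1 x"]) auto
  next
    show "continuous_on {z..z+h} s"
      by (rule continuous_at_imp_continuous_on)
        (use h z in \<open>auto intro!: DERIV_isCont[OF s1]\<close>)
  qed
  then show ?thesis using h z by (intro bexI[of _ "z + h"]) auto
qed

text \<open>By the intermediate value theorem, a change of sign would produce a zero. This serves
  both for \<open>s\<close> on the closed interval and for \<open>s1\<close> on (0,1).\<close>

lemma nonzero_continuous_same_sign:
  fixes g :: "real \<Rightarrow> real"
  assumes cont: "continuous_on S g" and conn: "connected S"
    and nz: "\<And>x. x \<in> S \<Longrightarrow> g x \<noteq> 0" and p: "p \<in> S" "g p > 0" and q: "q \<in> S"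
  shows "g q > 0"
proof (rule ccontr)
  assume "\<not> g q > 0"
  moreover have "connected (g ` S)" using cont conn by (rule connected_continuous_image)
  ultimately have "0 \<in> g ` S"
    using p q connected_contains_Icc[of "g ` S" "g q" "g p"] by force
  then show False using nz by auto
qed

theorem theorem3p5:
  fixes \<epsilon> \<omega> B :: real and s \<theta> :: "real \<Rightarrow> real"
  assumes "\<epsilon> \<ge> 0"
    and "\<omega> \<in> {-1/2..1/2}"
    and "bvp_solution \<epsilon> \<omega> B s \<theta>"
    and "B \<noteq> 0"
  shows "(\<forall>y\<in>{-1..1}. s y = s (-y)) \<and>
         (\<forall>y\<in>{-1..1}. \<theta> y = - \<theta> (-y)) \<and>
         s 0 > 0 \<and>
         (\<forall>y. is_arg_min s (\<lambda>x. x \<in> {-1..1}) y \<longleftrightarrow> y = 0) \<and>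
         (\<forall>y. local_min_on {-1..1} s y \<longleftrightarrow> y = 0)"
proof -
  obtain s1 s2 \<theta>1 where
    s1: "\<And>y. y\<in>{-1..1} \<Longrightarrow> (s has_real_derivative s1 y) (at y within {-1..1})"
    and s2: "\<And>y. y\<in>{-1..1} \<Longrightarrow> (s1 has_real_derivative s2 y) (at y within {-1..1})"
    and \<theta>1: "\<And>y. y\<in>{-1..1} \<Longrightarrow> (\<theta> has_real_derivative \<theta>1 y) (at y within {-1..1})"
    and ode: "\<And>y. y\<in>{-1..1} \<Longrightarrow> s2 y = 4 * s y * (\<theta>1 y)\<^sup>2 + \<epsilon> * s y * ((s y)\<^sup>2 - 1)"
    and B: "\<And>y. y\<in>{-1..1} \<Longrightarrow> (s y)\<^sup>2 * \<theta>1 y = B"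
    and bc: "s (-1) = 1" "s 1 = 1" "\<theta> (-1) = - \<omega> * pi" "\<theta> 1 = \<omega> * pi"
    using assms(3) unfolding bvp_solution_def by metis
  have int: "at y within {-1..1} = at y" if "y \<in> {-1<..<1}" for y :: real
    using that at_within_Icc_at[of "-1" y 1] by simp
  have s1': "(s has_real_derivative s1 y) (at y)" if "y \<in> {-1<..<1}" for y
    using s1[of y] int[OF that] that by simp
  have cont: "continuous_on {-1..1} s" using s1 by (rule DERIV_continuous_on)
  have cont1: "continuous_on {-1..1} s1" using s2 by (rule DERIV_continuous_on)

  \<comment> \<open>Positivity and the autonomous equation\<close>
  have nz: "s y \<noteq> 0" if "y \<in> {-1..1}" for y
    using B[OF that] \<open>B \<noteq> 0\<close> by auto
  have pos: "s y > 0" if "y \<in> {-1..1}" for y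
    by (rule nonzero_continuous_same_sign[OF cont _ nz, where p = 1]) (use bc that in auto)
  \<comment> \<open>Substituting \<theta>' = B/s^2 into the first equation eliminates \<theta> and
    leaves s'' = f(s).\<close>
  define f where "f = (\<lambda>x. 4 * B\<^sup>2 / x ^ 3 + \<epsilon> * x * (x\<^sup>2 - 1))"
  have f: "s2 y = f (s y)" if "y \<in> {-1..1}" for y
  proof -
    have "\<theta>1 y = B / (s y)\<^sup>2" using B[OF that] nz[OF that] by (simp add: field_simps)
    then show ?thesis using nz[OF that] ode[OF that]
      by (simp add: f_def power_divide power2_eq_square power3_eq_cube)
  qed
  have f_pos: "f x > 0" if "x \<ge> 1" for x
  proof -
    have "1 \<le> x\<^sup>2" using that by simp
    then have "0 \<le> \<epsilon> * x * (x\<^sup>2 - 1)" using \<open>\<epsilon> \<ge> 0\<close> that by simp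
    moreover have "0 < 4 * B\<^sup>2 / x ^ 3" using that \<open>B \<noteq> 0\<close> by simp
    ultimately show ?thesis unfolding f_def by linarith
  qed
  have lt1: "s y < 1" if y: "y \<in> {-1<..<1}" for y
  proof (rule ccontr)
    assume "\<not> s y < 1"
    obtain m where m: "m \<in> {-1..1}" "\<And>x. x \<in> {-1..1} \<Longrightarrow> s x \<le> s m"
      using continuous_attains_sup[OF compact_Icc _ cont] by auto
    \<comment> \<open>The maximum must be attained in the interior for \<open>s1\<close> to vanish
      there. If \<open>m\<close> is an endpoint, the maximum is 1, and the assumed point
      \<open>y\<close> with value at least 1 attains it too.\<close>
    obtain z where z: "z \<in> {-1<..<1}" "s z \<ge> 1" "\<And>x. x \<in> {-1..1} \<Longrightarrow> s x \<le> s z"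
    proof (cases "m \<in> {-1<..<1}")
      case True
      then show thesis using that[of m] m bc by force
    next
      case False
      then have "s m = 1" using m(1) bc by (metis atLeastAtMost_iff greaterThanLessThan_iff less_le)
      then show thesis using that[of y] m(2) y \<open>\<not> s y < 1\<close> by force
    qed
    have "s1 z = 0"
      by (rule DERIV_local_max[OF s1'[OF z(1)], of "min (z + 1) (1 - z)"])
        (use z in \<open>auto intro!: z(3)\<close>)
    moreover have "(s1 has_real_derivative f (s z)) (at z)"
      using s2[of z] f[of z] int[OF z(1)] z by simp
    ultimately have "\<exists>x\<in>{-1<..<1}. s x > s z"
      using not_local_max_if_second_deriv_pos[OF s1' _ f_pos[OF z(2)] z(1)] by blast
    then obtain x where "x \<in> {-1<..<1}" "s x > s z" by blast
    then show False using z(3)[of x] by simp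
  qed

  \<comment> \<open>Critical points and symmetry\<close>
  obtain m where m: "m \<in> {-1..1}" "\<And>x. x \<in> {-1..1} \<Longrightarrow> s m \<le> s x"
    using continuous_attains_inf[OF compact_Icc _ cont] by auto
  \<comment> \<open>Neither endpoint can be the minimizer: both have value 1, while
    \<open>s 0 < 1\<close>.\<close>
  have m_int: "m \<in> {-1<..<1}"
    using m(2)[of 0] lt1[of 0] bc m(1)
    by (metis atLeastAtMost_iff greaterThanLessThan_iff less_le linorder_not_less
        neg_le_0_iff_le zero_le_one neg_less_0_iff_less zero_less_one)
  have range: "s y \<in> {s m..1}" if "y \<in> {-1..1}" for y
    using m(2)[OF that] lt1[of y] that bc by (cases "y = 1 \<or> y = -1") auto
  \<comment> \<open>\<open>f\<close> is singular at 0, but \<open>s\<close> stays in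
    \<open>{s m..1}\<close> with \<open>s m > 0\<close>, where \<open>f\<close> is continuously
    differentiable.\<close>
  obtain L where lip: "L-lipschitz_on {s m..1} f"
  proof (rule C1_imp_lipschitz_on_Icc)
    fix x assume "x \<in> {s m..1}"
    then have "x \<noteq> 0" using pos[OF m(1)] by auto
    then show "(f has_real_derivative (- 12 * B\<^sup>2 / x ^ 4 + \<epsilon> * (3 * x\<^sup>2 - 1))) (at x within {s m..1})"
      unfolding f_def
      by (auto intro!: derivative_eq_intros simp: field_simps power2_eq_square power3_eq_cube power4_eq_xxxx)
  next
    show "continuous_on {s m..1} (\<lambda>x. - 12 * B\<^sup>2 / x ^ 4 + \<epsilon> * (3 * x\<^sup>2 - 1))"
      using pos[OF m(1)] by (auto intro!: continuous_intros)
  qed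
  have refl: "s (c + T) = s (c - T)" if "s1 c = 0" "0 \<le> T" "-1 \<le> c - T" "c + T \<le> 1" for c T
    by (rule autonomous_ode_reflection[OF lip s1 _ range that]) (use s2 f in auto)
  have crit: "c = 0" if c: "c \<in> {-1<..<1}" "s1 c = 0" for c
  proof (rule ccontr)
    assume "c \<noteq> 0"
    then consider "c > 0" | "c < 0" by linarith
    then show False
    proof cases
      case 1
      \<comment> \<open>Here \<open>T\<close> is the distance to the nearer endpoint 1, whose mirror
        image \<open>2 * c - 1\<close> lies in the interior.\<close>
      then show False using refl[of c "1 - c"] lt1[of "c - (1 - c)"] bc c by auto
    next
      case 2
      then show False using refl[of c "1 + c"] lt1[of "c + (1 + c)"] bc c by auto
    qed
  qed
  have "s1 m = 0"
    by (rule DERIV_local_min[OF s1'[OF m_int], of "min (m + 1) (1 - m)"])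
      (use m_int in \<open>auto intro!: m(2)\<close>)
  then have s10: "s1 0 = 0" using crit[OF m_int] by simp
  have even: "s y = s (-y)" if "y \<in> {-1..1}" for y
    using refl[OF s10, of y] refl[OF s10, of "-y"] that by (cases "y \<ge> 0") auto
  \<comment> \<open>Since \<open>s\<close> is even, so is \<theta>' = B/s^2. Hence
    \<open>\<theta> y + \<theta> (-y)\<close> is constant, and the boundary values make the constant
    0.\<close>
  have odd: "\<theta> y = - \<theta> (-y)" if y: "y \<in> {-1..1}" for y
  proof -
    have "((\<lambda>y. \<theta> y + \<theta> (-y)) has_real_derivative 0) (at x within {-1..1})"
      if x: "x \<in> {-1..1}" for x
    proof -
      have x': "-x \<in> {-1..1}" using x by auto
      have img: "uminus ` {-1..1} = {-1..1::real}" by auto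
      have "(\<theta> \<circ> uminus has_real_derivative \<theta>1 (-x) * -1) (at x within {-1..1})"
        by (rule DERIV_image_chain) (use \<theta>1[OF x'] img in \<open>auto intro!: derivative_eq_intros\<close>)
      moreover have "\<theta>1 (-x) = \<theta>1 x"
      proof -
        have "(s x)\<^sup>2 * \<theta>1 (-x) = (s x)\<^sup>2 * \<theta>1 x" using B[OF x] B[OF x'] even[OF x] by simp
        then show ?thesis using nz[OF x] by simp
      qed
      ultimately show ?thesis using DERIV_add[OF \<theta>1[OF x], of "\<theta> \<circ> uminus"] by (force simp: o_def)
    qed
    then obtain k where "\<And>x. x \<in> {-1..1} \<Longrightarrow> \<theta> x + \<theta> (-x) = k"
      using has_field_derivative_zero_constant[of "{-1..1}" "\<lambda>y. \<theta> y + \<theta> (-y)"] by auto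
    from this[OF y] this[of 1] bc show ?thesis by simp
  qed

  \<comment> \<open>Monotonicity and uniqueness of the minimum\<close>
  have s1_pos: "s1 y > 0" if y: "y \<in> {0<..<1}" for y
  proof -
    \<comment> \<open>Because \<open>s 0 < s 1\<close>, the mean value theorem gives one point of
      positive slope. Without critical points in (0,1), this sign spreads to the whole
      interval.\<close>
    obtain x where x: "0 < x" "x < 1" "s 1 - s 0 = s1 x * (1 - 0)"
    proof (rule mvt)
      show "continuous_on {0..1} s" using continuous_on_subset[OF cont] by auto
      show "(s has_derivative (*) (s1 x)) (at x)" if "0 < x" "x < 1" for x
        using s1'[of x] that by (simp add: has_field_derivative_def)
    qed auto
    have "s1 x > 0" using x lt1[of 0] bc by simp
    show ?thesis
    proof (rule nonzero_continuous_same_sign[where g = s1 and q = y])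
      show "continuous_on {0<..<1} s1" by (rule continuous_on_subset[OF cont1]) auto
      show "x \<in> {0<..<1}" using x by simp
      show "s1 z \<noteq> 0" if "z \<in> {0<..<1}" for z using crit[of z] that by auto
    qed (use y \<open>s1 x > 0\<close> in auto)
  qed
  have inc: "s x < s y" if "0 \<le> x" "x < y" "y \<le> 1" for x y
  proof (rule DERIV_pos_imp_increasing_open[OF that(2), where f = s])
    show "continuous_on {x..y} s" using continuous_on_subset[OF cont] that by auto
    show "\<exists>D. (s has_real_derivative D) (at z) \<and> D > 0" if "x < z" "z < y" for z
      using s1'[of z] s1_pos[of z] that \<open>0 \<le> x\<close> \<open>y \<le> 1\<close> by (intro exI[of _ "s1 z"]) simp
  qed
  have inc_abs: "s x < s y" if "\<bar>x\<bar> < \<bar>y\<bar>" "\<bar>y\<bar> \<le> 1" for x y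
  proof -
    have "s \<bar>z\<bar> = s z" if "\<bar>z\<bar> \<le> 1" for z
      using even[of z] that by (cases "z \<ge> 0") auto
    then show ?thesis using inc[of "\<bar>x\<bar>" "\<bar>y\<bar>"] that by simp
  qed
  have min0: "s 0 \<le> s y" if "y \<in> {-1..1}" for y
    using inc_abs[of 0 y] that by (cases "y = 0") (auto simp: abs_le_iff)
  have arg: "is_arg_min s (\<lambda>x. x \<in> {-1..1}) y \<longleftrightarrow> y = 0" for y
  proof
    assume "is_arg_min s (\<lambda>x. x \<in> {-1..1}) y"
    then have "y \<in> {-1..1}" "\<not> s 0 < s y" unfolding is_arg_min_def by auto
    then show "y = 0" using inc_abs[of 0 y] by (auto simp: abs_le_iff)
  next
    assume "y = 0"
    then show "is_arg_min s (\<lambda>x. x \<in> {-1..1}) y"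
      using min0 unfolding is_arg_min_def by (auto simp: not_less)
  qed
  have loc: "local_min_on {-1..1} s y \<longleftrightarrow> y = 0" for y
  proof
    assume "local_min_on {-1..1} s y"
    then obtain d where d: "y \<in> {-1..1}" "d > 0" "\<And>z. z \<in> {-1..1} \<Longrightarrow> \<bar>z - y\<bar> < d \<Longrightarrow> s y \<le> s z"
      unfolding local_min_on_def by blast
    show "y = 0"
    proof (rule ccontr)
      assume "y \<noteq> 0"
      \<comment> \<open>A step of length \<open>h\<close> from \<open>y\<close> towards 0 neither
        leaves the \<open>d\<close>-neighbourhood nor reaches 0, so it lowers the absolute value and
        with it \<open>s\<close>.\<close>
      define h where "h = min d \<bar>y\<bar> / 2"
      define z where "z = y - sgn y * h"
      have "0 < h" "h < d" "h < \<bar>y\<bar>" using \<open>y \<noteq> 0\<close> d by (auto simp: h_def min_def field_simps)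
      then have "\<bar>z\<bar> < \<bar>y\<bar>" "\<bar>z - y\<bar> < d"
        using \<open>y \<noteq> 0\<close> by (auto simp: z_def sgn_if abs_if split: if_splits)
      moreover have "\<bar>y\<bar> \<le> 1" using d(1) by (auto simp: abs_le_iff)
      moreover from calculation have "z \<in> {-1..1}" unfolding atLeastAtMost_iff by linarith
      ultimately show False using d(3)[of z] inc_abs[of z y] by simp
    qed
  next
    assume "y = 0"
    then show "local_min_on {-1..1} s y"
      unfolding local_min_on_def using min0 by (auto intro!: exI[of _ 1])
  qed
  have "s 0 > 0" using pos by simp
  then show ?thesis using even odd arg loc by (intro conjI ballI allI)
qed

end
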